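(* Let $\mathscr G=\{\mathsf H_1,\dots,\mathsf H_{n_0}\}$, $n_0\ge1$, be a finite collection of Hénon maps of degrees $d_1,\dots,d_{n_0}$, and let $D_{\mathscr G}=\sum_{i=1}^{n_0}d_i$. For $k\ge1$ and $z\in\mathbb C^2$ put $$G_k^+(z)=\frac1{D_{\mathscr G}^k}\sum_{h\in\mathscr G_k}\log^+\|h(z)\|,\qquad G_k^-(z)=\frac1{D_{\mathscr G}^k}\sum_{h\in\mathscr G_k}\log^+\|h^{-1}(z)\|.$$ Then the sequences $\{G_k^+\}$ and $\{G_k^-\}$ converge pointwise on $\mathbb C^2$ to plurisubharmonic, continuous functions $G_{\mathscr G}^+$ and $G_{\mathscr G}^-$, respectively.
   Context: A Hénon map here means a polynomial automorphism of $\mathbb C^2$ of the form $H_1\circ\cdots\circ H_m$, $m\ge1$, where each $H_j(x,y)=(y,p_j(y)-a_jx)$ with $a_j\ne0$ and $p_j$ a polynomial of degree at least $2$; its degree is its degree as a polynomial map (equivalently $\prod_j\deg p_j\ge 2$). $\mathscr G_k$ is the family of all compositions $\mathsf H_{i_1}\circ\cdots\circ\mathsf H_{i_k}$ with $1\le i_j\le n_0$; sums over $h\in\mathscr G_k$ run over all $n_0^k$ words $(i_1,\dots,i_k)$. $\|\cdot\|$ is the supremum norm on $\mathbb C^2$, and $\log^+x=\max\{\log x,0\}$ (with $\log^+0=0$). *)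

theory Defs
  imports "HOL-Analysis.Analysis" "HOL-Computational_Algebra.Polynomial"
begin

type_synonym C2 = "complex \<times> complex"

(* The library's norm on a product type is the Euclidean one, hence this separate definition. *)
definition sup_norm :: "C2 \<Rightarrow> real" where
  "sup_norm z = max (cmod (fst z)) (cmod (snd z))"

definition log_plus :: "real \<Rightarrow> real" where
  "log_plus x = (if x = 0 then 0 else max (ln x) 0)"

definition compose_list :: "('a \<Rightarrow> 'a) list \<Rightarrow> 'a \<Rightarrow> 'a" where
  "compose_list fs = foldr (\<circ>) fs id"

definition elementary_henon :: "complex poly \<Rightarrow> complex \<Rightarrow> C2 \<Rightarrow> C2" where
  "elementary_henon p a = (\<lambda>(x, y). (y, poly p y - a * x))"

definition henon_map :: "(C2 \<Rightarrow> C2) \<Rightarrow> bool" where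
  "henon_map H \<longleftrightarrow>
     (\<exists>Hs. Hs \<noteq> [] \<and> H = compose_list Hs \<and>
        (\<forall>h\<in>set Hs. \<exists>p a. degree p \<ge> 2 \<and> a \<noteq> 0 \<and> h = elementary_henon p a))"

definition poly_fun_deg_le :: "nat \<Rightarrow> (C2 \<Rightarrow> complex) \<Rightarrow> bool" where
  "poly_fun_deg_le n f \<longleftrightarrow>
     (\<exists>c :: nat \<Rightarrow> nat \<Rightarrow> complex.
        \<forall>x y. f (x, y) = (\<Sum>i\<le>n. \<Sum>j\<le>n - i. c i j * x ^ i * y ^ j))"

(* Degree as a polynomial map: the maximum of the total degrees of the two components.
   Over the infinite field of complex numbers a polynomial is determined by its function.
   Meaningful only if both components are polynomial. *)
definition map_degree :: "(C2 \<Rightarrow> C2) \<Rightarrow> nat" where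
  "map_degree F =
     (LEAST n. poly_fun_deg_le n (fst \<circ> F) \<and> poly_fun_deg_le n (snd \<circ> F))"

definition words :: "nat \<Rightarrow> nat \<Rightarrow> nat list set" where
  "words n k = {w. length w = k \<and> set w \<subseteq> {1..n}}"

definition total_degree :: "nat \<Rightarrow> (nat \<Rightarrow> C2 \<Rightarrow> C2) \<Rightarrow> nat" where
  "total_degree n H = (\<Sum>i=1..n. map_degree (H i))"

definition green_plus :: "nat \<Rightarrow> (nat \<Rightarrow> C2 \<Rightarrow> C2) \<Rightarrow> nat \<Rightarrow> C2 \<Rightarrow> real" where
  "green_plus n H k z =
     (\<Sum>w\<in>words n k. log_plus (sup_norm (compose_list (map H w) z))) / real (total_degree n H) ^ k"

definition green_minus :: "nat \<Rightarrow> (nat \<Rightarrow> C2 \<Rightarrow> C2) \<Rightarrow> nat \<Rightarrow> C2 \<Rightarrow> real" where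
  "green_minus n H k z =
     (\<Sum>w\<in>words n k. log_plus (sup_norm (inv (compose_list (map H w)) z))) / real (total_degree n H) ^ k"

definition upper_semicontinuous_on :: "'a::topological_space set \<Rightarrow> ('a \<Rightarrow> real) \<Rightarrow> bool" where
  "upper_semicontinuous_on U u \<longleftrightarrow>
     (\<forall>z\<in>U. \<forall>c>u z. eventually (\<lambda>w. u w < c) (at z within U))"

(* Subharmonicity of a real-valued (nowhere minus infinity) function.  The circle integral of an
   upper semicontinuous function always exists in [-infinity, infinity); the sub-mean value
   inequality then bounds it below by a real number, so integrability is part of the inequality.
   It is stated explicitly because the library's integral of a non-integrable function is 0. *)
definition subharmonic_on :: "complex set \<Rightarrow> (complex \<Rightarrow> real) \<Rightarrow> bool" where
  "subharmonic_on U u \<longleftrightarrow>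
     open U \<and> upper_semicontinuous_on U u \<and>
     (\<forall>a r. r > 0 \<longrightarrow> cball a r \<subseteq> U \<longrightarrow>
        set_integrable lborel {0..2 * pi} (\<lambda>t. u (a + of_real r * cis t)) \<and>
        u a \<le> (LBINT t:{0..2 * pi}. u (a + of_real r * cis t)) / (2 * pi))"

definition complex_line :: "C2 \<Rightarrow> C2 \<Rightarrow> complex \<Rightarrow> C2" where
  "complex_line a b s = (fst a + s * fst b, snd a + s * snd b)"

definition plurisubharmonic_on :: "C2 set \<Rightarrow> (C2 \<Rightarrow> real) \<Rightarrow> bool" where
  "plurisubharmonic_on U u \<longleftrightarrow>
     open U \<and> upper_semicontinuous_on U u \<and>
     (\<forall>a b. subharmonic_on (complex_line a b -` U) (u \<circ> complex_line a b))"

end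

theory Submission
  imports Defs "HOL-Complex_Analysis.Conformal_Mappings"
begin

text \<open>On the region \<open>V\<^sup>+ = {\<bar>y\<bar> \<ge> R, \<bar>x\<bar> \<le> \<bar>y\<bar>}\<close> a Henon map of degree \<open>d\<close> multiplies \<open>log\<^sup>+ \<parallel>z\<parallel>\<close> by
  \<open>d\<close> up to a bounded error, and \<open>V\<^sup>+\<close> is forward invariant; as long as an orbit has not entered
  \<open>V\<^sup>+\<close>, its norm does not exceed the larger of \<open>R\<close> and the initial norm. Hence
  \<open>\<bar>G\<^sub>k\<^sub>+\<^sub>1 - G\<^sub>k\<bar>\<close> is bounded by a multiple of \<open>(n\<^sub>0 / D)\<^sup>k\<close> on every ball, where \<open>D \<ge> 2 n\<^sub>0\<close>. So the
  convergence is locally uniform, and the limit inherits continuity and the sub-mean value inequality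
  on complex lines.\<close>

section \<open>Sub-mean values of logarithms of entire functions\<close>

text \<open>The obstacle is that the lower growth estimate fails off the vertical region:
  \<open>(x, 0)\<close> with \<open>x\<close> large goes to \<open>(0, poly p 0 - a * x)\<close>,
  whose norm is only of the order of the norm of \<open>x\<close>. Errors are therefore bounded on
  balls only, and orbit points off the region have to be confined by the initial norm. Words are
  lengthened at their outermost letter. At a point \<open>y\<close> reached by a word of length
  \<open>k\<close>, the sum over \<open>i\<close> of \<open>log_norm (F i y)\<close> is compared
  with \<open>D * log_norm y\<close>; since \<open>D\<close> is the sum of the degrees, the main
  terms cancel and only local errors of single maps remain. There are \<open>n ^ k\<close> such
  words against a denominator \<open>D ^ (k + 1)\<close>. The degree enters the averages through
  \<open>map_degree\<close>, a least number over all coefficient tables. It is identified by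
  comparing growth rates rather than by tracking leading terms.\<close>

lemma riemann_sum_le_integral:
  fixes v :: "real \<Rightarrow> real"
  assumes "continuous_on UNIV v" and "h \<ge> 0"
    and "\<And>j x. j < N \<Longrightarrow> x \<in> {t + real j * h..t + real (Suc j) * h} \<Longrightarrow> v (t + real j * h) \<le> v x + e"
  shows "h * (\<Sum>j<N. v (t + real j * h)) \<le> integral {t..t + real N * h} v + real N * h * e"
  using assms(3)
proof (induction N)
  case 0
  then show ?case by simp
next
  case (Suc N)
  have int: "v integrable_on {a..b}" for a b
    by (rule integrable_continuous_interval) (use assms(1) continuous_on_subset in blast)
  let ?a = "t + real N * h" and ?b = "t + real (Suc N) * h"
  have "h * v ?a - h * e = integral {?a..?b} (\<lambda>_. v ?a - e)"
    using assms(2) by (simp add: algebra_simps)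
  also have "\<dots> \<le> integral {?a..?b} v"
  proof (rule integral_le)
    fix x assume "x \<in> {?a..?b}"
    then show "v ?a - e \<le> v x" using Suc.prems[of N x] by simp
  qed (auto intro: int)
  finally have 1: "h * v ?a - h * e \<le> integral {?a..?b} v" .
  have "integral {t..?a} v + integral {?a..?b} v = integral {t..?b} v"
    using assms(2) by (intro Henstock_Kurzweil_Integration.integral_combine int) (auto simp: algebra_simps)
  moreover have "h * (\<Sum>j<N. v (t + real j * h)) \<le> integral {t..?a} v + real N * h * e"
    using Suc.prems by (intro Suc.IH) auto
  ultimately show ?case using 1 by (simp add: algebra_simps)
qed

text \<open>The polygon used below starts at an arbitrary angle \<open>t\<close>, so its Riemann sum
  sees the window from \<open>t\<close> to \<open>t + 2 * pi\<close>. Periodicity makes the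
  resulting bound independent of \<open>t\<close>.\<close>

lemma integral_over_period:
  fixes v :: "real \<Rightarrow> real"
  assumes cont: "continuous_on UNIV v" and "\<And>x. v (x + p) = v x" and "t \<ge> 0" "p \<ge> 0"
  shows "integral {t..t + p} v = integral {0..p} v"
proof -
  have int: "v integrable_on {a..b}" for a b
    by (rule integrable_continuous_interval) (use assms(1) continuous_on_subset in blast)
  have "integral {p..t + p} v = integral {0..t} (v \<circ> (\<lambda>x. x + p))"
    using integral_shift_Icc_real[of 0 t v p] by (simp add: comp_def add.commute)
  also have "\<dots> = integral {0..t} v" using assms(2) by (simp add: comp_def)
  finally have "integral {p..t + p} v = integral {0..t} v" .
  moreover have "integral {0..t} v + integral {t..t + p} v = integral {0..t + p} v"
    using assms by (intro Henstock_Kurzweil_Integration.integral_combine int) auto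
  moreover have "integral {0..p} v + integral {p..t + p} v = integral {0..t + p} v"
    using assms by (intro Henstock_Kurzweil_Integration.integral_combine int) auto
  ultimately show ?thesis by simp
qed

text \<open>This is the sub-mean value property of \<open>log \<bar>f\<bar>\<close>, in a form that avoids the singularities at
  the zeros of \<open>f\<close>: the maximum principle is applied to the product of the values of \<open>f\<close> at the
  vertices of a regular polygon, and the sum of \<open>u\<close> over the vertices is a Riemann sum.\<close>

lemma norm_le_exp_circle_mean:
  fixes f :: "complex \<Rightarrow> complex" and u :: "complex \<Rightarrow> real"
  assumes f: "f holomorphic_on UNIV" and u: "continuous_on UNIV u"
    and le: "\<And>s. norm (f s) \<le> exp (u s)" and r: "r > 0"
  shows "norm (f a) \<le> exp (integral {0..2*pi} (\<lambda>t. u (a + of_real r * cis t)) / (2 * pi))"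
proof -
  define v where "v = (\<lambda>t. u (a + of_real r * cis t))"
  define I where "I = integral {0..2*pi} v"
  have cv: "continuous_on UNIV v"
    unfolding v_def by (intro continuous_intros continuous_on_compose2[OF u]) auto
  have per: "v (x + 2 * pi) = v x" for x
    by (simp add: v_def flip: cis_mult)
  have key: "norm (f a) \<le> exp (I / (2 * pi) + e)" if e: "e > 0" for e
  proof -
    \<comment> \<open>The start angle is below \<open>2 * pi\<close> and the nodes run through one
      further turn, hence an interval of length \<open>4 * pi\<close>.\<close>
    have "uniformly_continuous_on {0..4*pi} v"
      by (intro compact_uniformly_continuous continuous_on_subset[OF cv]) auto
    then obtain d where d: "d > 0" 
        "\<And>x y. x \<in> {0..4*pi} \<Longrightarrow> y \<in> {0..4*pi} \<Longrightarrow> dist x y < d \<Longrightarrow> dist (v x) (v y) < e"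
      using e unfolding uniformly_continuous_on_def by meson
    obtain N where N: "N > 0" "2 * pi / real N < d"
    proof -
      obtain N :: nat where "2 * pi / d < real N" using reals_Archimedean2 by blast
      moreover from this have "N > 0" using d(1)
        by (metis divide_pos_pos gr0I less_asym mult_pos_pos of_nat_0 pi_gt_zero zero_less_numeral)
      ultimately show ?thesis using that[of N] d(1) by (simp add: field_simps)
    qed
    define h where "h = 2 * pi / real N"
    have h: "h > 0" "real N * h = 2 * pi" "h < d" using N by (auto simp: h_def)
    \<comment> \<open>For \<open>s\<close> on the circle of radius \<open>r\<close> the factors sit
      at the polygon's vertices; at \<open>s = 0\<close> all of them equal \<open>f a\<close>. So
      \<open>F 0 = f a ^ N\<close>, and taking \<open>N\<close>-th roots undoes the factor
      \<open>N\<close> in the bound for the Riemann sum.\<close>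
    define F where "F = (\<lambda>s. \<Prod>j<N. f (a + cis (real j * h) * s))"
    have holF: "F holomorphic_on UNIV"
      unfolding F_def
      by (intro holomorphic_intros holomorphic_on_compose_gen[OF _ f, unfolded o_def]) auto
    have bd: "norm (F s) \<le> exp (real N * (I / (2 * pi) + e))" if s: "s \<in> frontier (cball 0 r)" for s
    proof -
      define t where "t = Arg2pi s"
      have t: "0 \<le> t" "t < 2 * pi" "s = of_real r * cis t"
        using s r Arg2pi[of s] by (auto simp: t_def is_Arg_def cis_conv_exp frontier_cball sphere_def)
      have "norm (F s) \<le> (\<Prod>j<N. exp (v (t + real j * h)))"
        unfolding F_def prod_norm[symmetric]
      proof (rule prod_mono, safe)
        fix j
        have "a + cis (real j * h) * s = a + of_real r * cis (t + real j * h)"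
          using t(3) by (simp add: cis_mult mult_ac add.commute flip: cis_mult)
        then show "norm (f (a + cis (real j * h) * s)) \<le> exp (v (t + real j * h))"
          unfolding v_def using le by metis
      qed auto
      also have "\<dots> = exp (\<Sum>j<N. v (t + real j * h))" by (simp add: exp_sum)
      also have "(\<Sum>j<N. v (t + real j * h)) \<le> real N * (I / (2 * pi) + e)"
      proof -
        have "h * (\<Sum>j<N. v (t + real j * h)) \<le> integral {t..t + real N * h} v + real N * h * e"
        proof (rule riemann_sum_le_integral[OF cv])
          fix j x assume j: "j < N" and x: "x \<in> {t + real j * h..t + real (Suc j) * h}"
          have "real (Suc j) * h \<le> real N * h" using j h(1) by (intro mult_right_mono) auto
          then have b: "real (Suc j) * h \<le> 2 * pi" using h by simp
          have c: "real (Suc j) * h = real j * h + h" by (simp add: algebra_simps)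
          have g: "0 \<le> real j * h" using h(1) by simp
          have "dist (v (t + real j * h)) (v x) < e"
          proof (rule d(2))
            show "x \<in> {0..4 * pi}" "t + real j * h \<in> {0..4 * pi}"
              using x t(1,2) h(1) b c g unfolding atLeastAtMost_iff by linarith+
            show "dist (t + real j * h) x < d"
              using x h(3) c unfolding atLeastAtMost_iff dist_real_def by linarith
          qed
          then show "v (t + real j * h) \<le> v x + e" by (simp add: dist_real_def)
        qed (use h in auto)
        also have "\<dots> = I + 2 * pi * e"
          using integral_over_period[OF cv per t(1)] h(2) by (simp add: I_def)
        finally have "(\<Sum>j<N. v (t + real j * h)) \<le> (I + 2 * pi * e) / h"
          using h(1) by (simp add: field_simps)
        also have "\<dots> = real N * (I / (2 * pi) + e)" using N(1) by (simp add: h_def field_simps)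
        finally show ?thesis .
      qed
      finally show ?thesis by simp
    qed
    have "norm (F 0) \<le> exp (real N * (I / (2 * pi) + e))"
      by (rule maximum_modulus_frontier[where S = "cball 0 r"])
         (use bd r in \<open>auto intro!: holomorphic_on_subset[OF holF] holomorphic_on_imp_continuous_on\<close>)
    then have "norm (f a) ^ N \<le> exp (I / (2 * pi) + e) ^ N"
      by (simp add: F_def norm_power exp_of_nat_mult)
    then show ?thesis using N(1) by (simp add: power_mono_iff)
  qed
  have "((\<lambda>e. exp (I / (2 * pi) + e)) \<longlongrightarrow> exp (I / (2 * pi) + 0)) (at_right 0)"
    by (intro tendsto_intros)
  then have "norm (f a) \<le> exp (I / (2 * pi) + 0)"
    by (rule tendsto_lowerbound) (auto simp: eventually_at_right_less intro!: eventually_mono[OF eventually_at_right_less key])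
  then show ?thesis by (simp add: I_def v_def)
qed

section \<open>Growth and escape of Henon maps\<close>

definition log_norm :: "C2 \<Rightarrow> real" where
  "log_norm z = log_plus (sup_norm z)"

lemma sup_norm_nonneg [simp]: "sup_norm z \<ge> 0"
  by (simp add: sup_norm_def le_max_iff_disj)

lemma sup_norm_le_norm: "sup_norm z \<le> norm z"
  using norm_fst_le[of "fst z" "snd z"] norm_snd_le[of "snd z" "fst z"] by (simp add: sup_norm_def)

text \<open>Truncating before the logarithm gives one formula that also covers norm 0, and
  continuity, monotonicity and \<open>exp\<close> apply to it directly.\<close>

lemma log_norm_eq: "log_norm z = ln (max 1 (sup_norm z))"
proof (cases "sup_norm z \<le> 1")
  case True
  then have "sup_norm z = 0 \<or> ln (sup_norm z) \<le> 0"
    using sup_norm_nonneg[of z] ln_le_zero_iff[of "sup_norm z"] by linarith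
  then show ?thesis using True by (auto simp: log_norm_def log_plus_def max_def)
qed (auto simp: log_norm_def log_plus_def max_def)

lemma log_norm_nonneg [simp]: "log_norm z \<ge> 0"
  by (simp add: log_norm_eq)

lemma exp_log_norm: "exp (log_norm z) = max 1 (sup_norm z)"
  by (simp add: log_norm_eq)

lemma log_norm_le_iff: "log_norm z \<le> c \<longleftrightarrow> 1 \<le> exp c \<and> sup_norm z \<le> exp c"
  by (metis exp_le_cancel_iff exp_log_norm max.bounded_iff)

text \<open>The region usually denoted \<open>V\<^sup>+\<close>, which Henon maps send into itself for large \<open>R\<close>.\<close>

definition vertical_region :: "real \<Rightarrow> C2 set" where
  "vertical_region R = {z. R \<le> cmod (snd z) \<and> cmod (fst z) \<le> cmod (snd z)}"

text \<open>All \<open>R \<ge> R\<^sub>0\<close> are included so that maps with different thresholds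
  can be composed over one common region. The lower estimate is confined to the region, and the last
  clause says that a point can be large and outside the region only if its preimage was already that
  large.\<close>

definition growth_bound :: "real \<Rightarrow> real \<Rightarrow> nat \<Rightarrow> (C2 \<Rightarrow> C2) \<Rightarrow> bool" where
  "growth_bound R\<^sub>0 C d F \<longleftrightarrow>
     (\<forall>z. log_norm (F z) \<le> real d * log_norm z + C) \<and>
     (\<forall>R\<ge>R\<^sub>0. \<forall>z.
        (z \<in> vertical_region R \<longrightarrow> F z \<in> vertical_region R \<and> real d * log_norm z \<le> log_norm (F z) + C) \<and>
        (F z \<notin> vertical_region R \<longrightarrow> sup_norm (F z) \<le> max (sup_norm z) R))"

lemma growth_boundD:
  assumes "growth_bound R\<^sub>0 C d F"
  shows "log_norm (F z) \<le> real d * log_norm z + C"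
    and "R \<ge> R\<^sub>0 \<Longrightarrow> z \<in> vertical_region R \<Longrightarrow> F z \<in> vertical_region R"
    and "R \<ge> R\<^sub>0 \<Longrightarrow> z \<in> vertical_region R \<Longrightarrow> real d * log_norm z \<le> log_norm (F z) + C"
    and "R \<ge> R\<^sub>0 \<Longrightarrow> F z \<notin> vertical_region R \<Longrightarrow> sup_norm (F z) \<le> max (sup_norm z) R"
  using assms unfolding growth_bound_def by blast+

lemma growth_bound_mono:
  assumes "growth_bound R\<^sub>0 C d F" "R\<^sub>0 \<le> R\<^sub>1" "C \<le> C'"
  shows "growth_bound R\<^sub>1 C' d F"
  using assms unfolding growth_bound_def by (meson add_left_mono order_trans)

lemma growth_bound_id: "growth_bound 0 0 1 id"
  by (auto simp: growth_bound_def)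

text \<open>The error \<open>C'\<close> of the inner map is multiplied by the degree
  \<open>d\<close> of the outer one, whence \<open>d * C' + C\<close>. If the final point is off the
  region, forward invariance puts the intermediate point off it too, so both norm bounds
  apply.\<close>

lemma growth_bound_compose:
  assumes F: "growth_bound R\<^sub>0 C d F" and G: "growth_bound R\<^sub>1 C' e G"
  shows "growth_bound (max R\<^sub>0 R\<^sub>1) (real d * C' + C) (d * e) (F \<circ> G)"
proof -
  note F = growth_boundD[OF F] and G = growth_boundD[OF G]
  show ?thesis
    unfolding growth_bound_def o_def
  proof (intro conjI allI impI)
    fix z
    have "log_norm (F (G z)) \<le> real d * log_norm (G z) + C" by (rule F)
    also have "\<dots> \<le> real d * (real e * log_norm z + C') + C"
      by (intro add_right_mono mult_left_mono G) auto
    finally show "log_norm (F (G z)) \<le> real (d * e) * log_norm z + (real d * C' + C)"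
      by (simp add: algebra_simps)
    fix R assume R: "max R\<^sub>0 R\<^sub>1 \<le> R"
    show "F (G z) \<in> vertical_region R" if "z \<in> vertical_region R" using that R F(2) G(2) by auto
    show "sup_norm (F (G z)) \<le> max (sup_norm z) R" if "F (G z) \<notin> vertical_region R"
    proof -
      have "G z \<notin> vertical_region R" using that F(2)[of R "G z"] R by auto
      then have "sup_norm (G z) \<le> max (sup_norm z) R" using G(4)[of R z] R by auto
      moreover have "sup_norm (F (G z)) \<le> max (sup_norm (G z)) R" using F(4)[of R "G z"] that R by auto
      ultimately show ?thesis by linarith
    qed
    assume z: "z \<in> vertical_region R"
    have "real d * (real e * log_norm z) \<le> real d * (log_norm (G z) + C')"
      using z R by (intro mult_left_mono G(3)[of R]) auto
    also have "\<dots> \<le> log_norm (F (G z)) + C + real d * C'"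
      using F(3)[of R "G z"] G(2)[of R z] z R by (simp add: algebra_simps)
    finally show "real (d * e) * log_norm z \<le> log_norm (F (G z)) + (real d * C' + C)"
      by (simp add: algebra_simps)
  qed
qed

lemma cmod_poly_le:
  assumes "cmod y \<le> t" "t \<ge> 1"
  shows "cmod (poly p y) \<le> (\<Sum>i\<le>degree p. cmod (coeff p i)) * t ^ degree p"
proof -
  have "cmod (poly p y) \<le> (\<Sum>i\<le>degree p. cmod (coeff p i * y ^ i))"
    unfolding poly_altdef by (rule norm_sum)
  also have "\<dots> \<le> (\<Sum>i\<le>degree p. cmod (coeff p i) * t ^ degree p)"
  proof (rule sum_mono)
    fix i assume "i \<in> {..degree p}"
    then have "cmod y ^ i \<le> t ^ degree p"
      using power_mono[OF assms(1), of i] power_increasing[of i "degree p" t] assms(2) by auto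
    then show "cmod (coeff p i * y ^ i) \<le> cmod (coeff p i) * t ^ degree p"
      by (simp add: norm_mult norm_power mult_left_mono)
  qed
  finally show ?thesis by (simp add: sum_distrib_right)
qed

text \<open>Dividing \<open>poly p y\<close> by \<open>y ^ degree p\<close> gives the reflected
  polynomial at \<open>inverse y\<close>, which tends to the leading coefficient. The factor 1/2
  leaves room for a strict inequality.\<close>

lemma poly_growth_at_infinity:
  fixes p :: "complex poly"
  assumes "p \<noteq> 0"
  shows "eventually (\<lambda>y. cmod (lead_coeff p) / 2 * cmod y ^ degree p \<le> cmod (poly p y)) at_infinity"
proof -
  have "((\<lambda>y. cmod (poly (reflect_poly p) (inverse y))) \<longlongrightarrow> cmod (poly (reflect_poly p) 0)) at_infinity"
    by (intro tendsto_intros tendsto_inverse_0)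
  moreover have "cmod (lead_coeff p) / 2 < cmod (poly (reflect_poly p) 0)"
    using assms by (simp add: poly_0_coeff_0)
  ultimately have "eventually (\<lambda>y. cmod (lead_coeff p) / 2 < cmod (poly (reflect_poly p) (inverse y))) at_infinity"
    by (rule order_tendstoD(1))
  moreover have "eventually (\<lambda>y::complex. y \<noteq> 0) at_infinity"
    using eventually_not_equal_at_infinity by blast
  ultimately show ?thesis
  proof eventually_elim
    case (elim y)
    have "poly p y = y ^ degree p * poly (reflect_poly p) (inverse y)"
      using elim(2) by (simp add: poly_reflect_poly_nz flip: power_mult_distrib)
    then show ?case using mult_left_mono[OF less_imp_le[OF elim(1)], of "cmod y ^ degree p"]
      by (simp add: norm_mult norm_power mult.commute)
  qed
qed

lemma elementary_henon_escape:
  fixes p :: "complex poly"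
  assumes "degree p \<ge> 2"
  obtains c R where "c > 0" "R \<ge> 1"
    "\<And>x y. R \<le> cmod y \<Longrightarrow> cmod x \<le> cmod y \<Longrightarrow>
       c * cmod y ^ degree p \<le> cmod (poly p y - a * x) \<and> cmod y \<le> cmod (poly p y - a * x)"
proof -
  have p: "p \<noteq> 0" using assms by auto
  obtain R\<^sub>1 where R1: "\<And>y. R\<^sub>1 \<le> cmod y \<Longrightarrow> cmod (lead_coeff p) / 2 * cmod y ^ degree p \<le> cmod (poly p y)"
    using poly_growth_at_infinity[OF p] by (auto simp: eventually_at_infinity)
  \<comment> \<open>One half of the leading coefficient is lost in the growth estimate, and half of
    the remainder is spent on absorbing \<open>a * x\<close>.\<close>
  define c where "c = cmod (lead_coeff p) / 4"
  have c: "c > 0" using p by (simp add: c_def)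
  \<comment> \<open>The entries give \<open>cmod y \<ge> 1\<close>, the growth estimate for
    \<open>p\<close>, \<open>cmod a \<le> c * cmod y\<close> and \<open>1 \<le> c * cmod y\<close>.
    Because the degree is at least 2, both \<open>cmod (a * x)\<close> and \<open>cmod y\<close> are
    then at most \<open>c * cmod y ^ degree p\<close>.\<close>
  define R where "R = Max {1, R\<^sub>1, cmod a / c, 1 / c}"
  have R: "R \<ge> 1" "R \<ge> R\<^sub>1" "R \<ge> cmod a / c" "R \<ge> 1 / c" by (auto simp: R_def)
  show ?thesis
  proof (rule that[OF c R(1)])
    fix x y assume y: "R \<le> cmod y" and x: "cmod x \<le> cmod y"
    have y1: "cmod y \<ge> 1" "cmod a \<le> c * cmod y" "1 \<le> c * cmod y"
      using R y c by (auto simp: field_simps intro: order_trans)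
    have sq: "c * cmod y * cmod y \<le> c * cmod y ^ degree p"
      using power_increasing[OF assms y1(1)] c by (simp add: power2_eq_square)
    have "cmod (a * x) \<le> c * cmod y * cmod y"
      unfolding norm_mult using y1 x by (intro mult_mono) auto
    moreover have "2 * c * cmod y ^ degree p \<le> cmod (poly p y)" using R1[of y] y R(2) by (simp add: c_def)
    moreover have "cmod (poly p y) \<le> cmod (poly p y - a * x) + cmod (a * x)"
      by (metis diff_add_cancel norm_triangle_ineq)
    ultimately have 1: "c * cmod y ^ degree p \<le> cmod (poly p y - a * x)" using sq by linarith
    have "cmod y \<le> c * cmod y * cmod y" using mult_right_mono[OF y1(3), of "cmod y"] by simp
    then show "c * cmod y ^ degree p \<le> cmod (poly p y - a * x) \<and> cmod y \<le> cmod (poly p y - a * x)"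
      using 1 sq by linarith
  qed
qed

lemma elementary_henon_growth:
  assumes p: "degree p \<ge> 2"
  shows "\<exists>R\<^sub>0 C. growth_bound R\<^sub>0 C (degree p) (elementary_henon p a)"
proof -
  let ?F = "elementary_henon p a" and ?d = "degree p"
  obtain c R\<^sub>0 where c: "c > 0" and R0: "R\<^sub>0 \<ge> 1" and esc:
    "\<And>x y. R\<^sub>0 \<le> cmod y \<Longrightarrow> cmod x \<le> cmod y \<Longrightarrow>
       c * cmod y ^ ?d \<le> cmod (poly p y - a * x) \<and> cmod y \<le> cmod (poly p y - a * x)"
    using elementary_henon_escape[OF p, of a] by blast
  define M where "M = (\<Sum>i\<le>?d. cmod (coeff p i)) + cmod a + 1"
  have M: "M \<ge> 1" by (simp add: M_def sum_nonneg)
  \<comment> \<open>\<open>ln M\<close> is the error of the upper estimate and \<open>- ln c\<close>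
    that of the lower one. The summand 1 in \<open>M\<close> makes \<open>M * t ^ ?d\<close>
    dominate the first coordinate and the truncation at 1 as well.\<close>
  define C where "C = max (ln M) (- ln c)"
  have up: "log_norm (?F z) \<le> real ?d * log_norm z + C" for z
  proof -
    obtain x y where z: "z = (x, y)" by fastforce
    define t where "t = max 1 (sup_norm z)"
    have t: "t \<ge> 1" "cmod x \<le> t" "cmod y \<le> t" by (auto simp: t_def z sup_norm_def)
    have td: "t \<le> t ^ ?d" "1 \<le> t ^ ?d" using p t(1) power_increasing[of 1 ?d t] by (auto simp: one_le_power)
    have "cmod (poly p y - a * x) \<le> cmod (poly p y) + cmod a * cmod x"
      by (metis norm_mult norm_triangle_ineq4)
    also have "\<dots> \<le> (\<Sum>i\<le>?d. cmod (coeff p i)) * t ^ ?d + cmod a * t ^ ?d"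
      using cmod_poly_le[OF t(3,1)] t td by (intro add_mono mult_left_mono) auto
    finally have "cmod (poly p y - a * x) \<le> M * t ^ ?d" using td by (simp add: M_def algebra_simps)
    moreover have "t ^ ?d \<le> M * t ^ ?d" using M td by simp
    then have "t \<le> M * t ^ ?d" using td by linarith
    ultimately have "max 1 (sup_norm (?F z)) \<le> M * t ^ ?d"
      using t unfolding z elementary_henon_def sup_norm_def by simp
    then have "log_norm (?F z) \<le> ln (M * t ^ ?d)"
      unfolding log_norm_eq by (subst ln_le_cancel_iff) (use M t in auto)
    also have "\<dots> = ln M + real ?d * log_norm z"
      using M t by (simp add: ln_mult ln_realpow log_norm_eq t_def)
    finally show ?thesis by (simp add: C_def)
  qed
  have low: "?F z \<in> vertical_region R \<and> real ?d * log_norm z \<le> log_norm (?F z) + C"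
    if R: "R \<ge> R\<^sub>0" and z: "z \<in> vertical_region R" for R z
  proof -
    obtain x y where xy: "z = (x, y)" by fastforce
    have y: "R \<le> cmod y" "cmod x \<le> cmod y" "1 \<le> cmod y" using z R R0 by (auto simp: vertical_region_def xy)
    have e: "c * cmod y ^ ?d \<le> cmod (poly p y - a * x)" "cmod y \<le> cmod (poly p y - a * x)"
      using esc[of y x] y R by auto
    have "real ?d * log_norm z + ln c = ln (c * cmod y ^ ?d)"
      using c y by (auto simp: log_norm_eq xy sup_norm_def ln_mult ln_realpow max_def)
    also have "\<dots> \<le> log_norm (?F z)"
      unfolding log_norm_eq
      by (rule ln_mono) (use c y e in \<open>auto simp: xy elementary_henon_def sup_norm_def intro!: mult_pos_pos zero_less_power\<close>)
    finally show ?thesis using y e by (auto simp: xy vertical_region_def elementary_henon_def C_def)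
  qed
  \<comment> \<open>If the image is off the region, its second coordinate is either below
    \<open>R\<close> or smaller than its first one, which is the old \<open>y\<close>.\<close>
  have out: "sup_norm (?F z) \<le> max (sup_norm z) R" if "?F z \<notin> vertical_region R" for R z
    using that by (cases z) (auto simp: vertical_region_def elementary_henon_def sup_norm_def)
  have "growth_bound R\<^sub>0 C ?d ?F" using up low out unfolding growth_bound_def by blast
  then show ?thesis by blast
qed

lemma compose_list_Nil [simp]: "compose_list [] = id"
  and compose_list_Cons [simp]: "compose_list (f # fs) = f \<circ> compose_list fs"
  by (simp_all add: compose_list_def)

lemma compose_list_append: "compose_list (fs @ gs) = compose_list fs \<circ> compose_list gs"
  by (induction fs) (auto simp: comp_assoc)

text \<open>The bound does not deteriorate with the length of the word: taking the maximum with
  \<open>R\<close> twice is the same as taking it once, and the region is never left again.\<close>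

lemma compose_list_dichotomy:
  assumes "\<And>f. f \<in> set fs \<Longrightarrow> \<exists>d. growth_bound R\<^sub>0 C d f" and "R \<ge> R\<^sub>0"
  shows "compose_list fs z \<in> vertical_region R \<or> sup_norm (compose_list fs z) \<le> max (sup_norm z) R"
  using assms(1)
proof (induction fs)
  case (Cons f fs)
  let ?y = "compose_list fs z"
  obtain d where "growth_bound R\<^sub>0 C d f" using Cons.prems by auto
  then have "?y \<in> vertical_region R \<Longrightarrow> f ?y \<in> vertical_region R"
    "f ?y \<notin> vertical_region R \<Longrightarrow> sup_norm (f ?y) \<le> max (sup_norm ?y) R"
    using growth_boundD(2,4) assms(2) by blast+
  moreover have "?y \<in> vertical_region R \<or> sup_norm ?y \<le> max (sup_norm z) R"
    using Cons by simp
  ultimately show ?case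
    by (cases "f ?y \<in> vertical_region R") (auto simp: le_max_iff_disj)
qed auto

section \<open>Degrees and inverses\<close>

lemma poly_fun_deg_le_iff:
  "poly_fun_deg_le n f \<longleftrightarrow> (\<exists>c. f = (\<lambda>z. \<Sum>i\<le>n. \<Sum>j\<le>n - i. c i j * (fst z ^ i * snd z ^ j)))"
  by (simp add: poly_fun_deg_le_def fun_eq_iff split_paired_all mult.assoc)

lemma poly_fun_deg_le_monomial:
  assumes "i + j \<le> n"
  shows "poly_fun_deg_le n (\<lambda>z. fst z ^ i * snd z ^ j)"
  unfolding poly_fun_deg_le_iff
proof (intro exI ext)
  fix z :: C2
  \<comment> \<open>Nested conditionals, rather than one on the pair, let the inner and the outer
    sum collapse one after the other.\<close>
  let ?c = "\<lambda>k l. if k = i then if l = j then 1 else 0 else 0"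
  have if_mult: "?c k l * m = (if k = i then if l = j then m else 0 else 0)" for k l and m :: complex
    by simp
  have "(\<Sum>l\<le>n - k. ?c k l * (fst z ^ k * snd z ^ l)) = (if k = i then fst z ^ i * snd z ^ j else 0)" for k
    unfolding if_mult using assms by (cases "k = i") (simp_all add: sum.delta)
  then show "fst z ^ i * snd z ^ j = (\<Sum>k\<le>n. \<Sum>l\<le>n - k. ?c k l * (fst z ^ k * snd z ^ l))"
    using assms by (simp add: sum.delta)
qed

lemma poly_fun_deg_le_add:
  assumes "poly_fun_deg_le n f" "poly_fun_deg_le n g"
  shows "poly_fun_deg_le n (\<lambda>z. f z + g z)"
proof -
  obtain c d where "f = (\<lambda>z. \<Sum>i\<le>n. \<Sum>j\<le>n - i. c i j * (fst z ^ i * snd z ^ j))"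
    "g = (\<lambda>z. \<Sum>i\<le>n. \<Sum>j\<le>n - i. d i j * (fst z ^ i * snd z ^ j))"
    using assms unfolding poly_fun_deg_le_iff by blast
  then have "(\<lambda>z. f z + g z) = (\<lambda>z. \<Sum>i\<le>n. \<Sum>j\<le>n - i. (c i j + d i j) * (fst z ^ i * snd z ^ j))"
    by (simp add: distrib_right sum.distrib)
  then show ?thesis unfolding poly_fun_deg_le_iff by (intro exI)
qed

lemma poly_fun_deg_le_scale:
  assumes "poly_fun_deg_le n f"
  shows "poly_fun_deg_le n (\<lambda>z. a * f z)"
proof -
  obtain c where "f = (\<lambda>z. \<Sum>i\<le>n. \<Sum>j\<le>n - i. c i j * (fst z ^ i * snd z ^ j))"
    using assms unfolding poly_fun_deg_le_iff by blast
  then have "(\<lambda>z. a * f z) = (\<lambda>z. \<Sum>i\<le>n. \<Sum>j\<le>n - i. (a * c i j) * (fst z ^ i * snd z ^ j))"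
    by (simp add: sum_distrib_left mult.assoc)
  then show ?thesis unfolding poly_fun_deg_le_iff by (intro exI)
qed

lemma poly_fun_deg_le_sum:
  assumes "\<And>k. k \<in> A \<Longrightarrow> poly_fun_deg_le n (f k)"
  shows "poly_fun_deg_le n (\<lambda>z. \<Sum>k\<in>A. f k z)"
proof -
  have 0: "poly_fun_deg_le n (\<lambda>z. 0)"
    using poly_fun_deg_le_scale[OF poly_fun_deg_le_monomial[of 0 0 n], of 0] by simp
  show ?thesis using assms
    by (induction A rule: infinite_finite_induct) (auto intro: 0 poly_fun_deg_le_add)
qed

text \<open>Coefficients of the product are never collected: it is expanded into monomials of total
  degree at most \<open>n + m\<close>, and closure under sums and scalars does the rest.\<close>

lemma poly_fun_deg_le_mult:
  assumes f: "poly_fun_deg_le n f" and g: "poly_fun_deg_le m g"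
  shows "poly_fun_deg_le (n + m) (\<lambda>z. f z * g z)"
proof -
  obtain c d where fg: "f = (\<lambda>z. \<Sum>i\<le>n. \<Sum>j\<le>n - i. c i j * (fst z ^ i * snd z ^ j))"
    "g = (\<lambda>z. \<Sum>k\<le>m. \<Sum>l\<le>m - k. d k l * (fst z ^ k * snd z ^ l))"
    using assms unfolding poly_fun_deg_le_iff by blast
  have monom: "fst z ^ i * snd z ^ j * g z = (\<Sum>k\<le>m. \<Sum>l\<le>m - k. d k l * (fst z ^ (i + k) * snd z ^ (j + l)))" for i j z
    by (simp add: fg(2) sum_distrib_left power_add mult_ac)
  have "(\<lambda>z. f z * g z) = (\<lambda>z. \<Sum>i\<le>n. \<Sum>j\<le>n - i. c i j *
      (\<Sum>k\<le>m. \<Sum>l\<le>m - k. d k l * (fst z ^ (i + k) * snd z ^ (j + l))))"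
    unfolding fg(1) sum_distrib_right mult.assoc[of "c _ _"] monom ..
  moreover have "poly_fun_deg_le (n + m) \<dots>"
    by (intro poly_fun_deg_le_sum poly_fun_deg_le_scale poly_fun_deg_le_monomial) auto
  ultimately show ?thesis by simp
qed

lemma poly_fun_deg_le_mono:
  assumes "poly_fun_deg_le n f" "n \<le> m"
  shows "poly_fun_deg_le m f"
proof -
  obtain c where f: "f = (\<lambda>z. \<Sum>i\<le>n. \<Sum>j\<le>n - i. c i j * (fst z ^ i * snd z ^ j))"
    using assms unfolding poly_fun_deg_le_iff by blast
  show ?thesis
    unfolding f using assms(2)
    by (intro poly_fun_deg_le_sum poly_fun_deg_le_scale poly_fun_deg_le_monomial) auto
qed

lemma poly_fun_deg_le_power:
  assumes "poly_fun_deg_le n f"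
  shows "poly_fun_deg_le (k * n) (\<lambda>z. f z ^ k)"
proof (induction k)
  case 0
  then show ?case using poly_fun_deg_le_monomial[of 0 0 0] by simp
next
  case (Suc k)
  then show ?case using poly_fun_deg_le_mult[OF assms Suc] by simp
qed

lemma poly_fun_deg_le_poly:
  assumes "poly_fun_deg_le n f"
  shows "poly_fun_deg_le (degree p * n) (\<lambda>z. poly p (f z))"
  unfolding poly_altdef
proof (intro poly_fun_deg_le_sum poly_fun_deg_le_scale)
  fix i assume "i \<in> {..degree p}"
  then show "poly_fun_deg_le (degree p * n) (\<lambda>z. f z ^ i)"
    using poly_fun_deg_le_mono[OF poly_fun_deg_le_power[OF assms]] by simp
qed

definition poly_map_deg_le :: "nat \<Rightarrow> (C2 \<Rightarrow> C2) \<Rightarrow> bool" where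
  "poly_map_deg_le n F \<longleftrightarrow> poly_fun_deg_le n (fst \<circ> F) \<and> poly_fun_deg_le n (snd \<circ> F)"

lemma poly_map_deg_le_id: "poly_map_deg_le 1 id"
  using poly_fun_deg_le_monomial[of 1 0 1] poly_fun_deg_le_monomial[of 0 1 1]
  by (simp add: poly_map_deg_le_def comp_def)

lemma poly_map_deg_le_elementary_henon:
  assumes F: "poly_map_deg_le n F" and "degree p \<ge> 1"
  shows "poly_map_deg_le (degree p * n) (elementary_henon p a \<circ> F)"
proof -
  have F: "poly_fun_deg_le n (\<lambda>z. fst (F z))" "poly_fun_deg_le n (\<lambda>z. snd (F z))"
    using F by (auto simp: poly_map_deg_le_def comp_def)
  have n: "n \<le> degree p * n" using assms(2) by simp
  have "poly_fun_deg_le (degree p * n) (\<lambda>z. poly p (snd (F z)) + (- a) * fst (F z))"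
    by (intro poly_fun_deg_le_add poly_fun_deg_le_poly poly_fun_deg_le_scale poly_fun_deg_le_mono[OF F(1) n] F(2))
  then show ?thesis
    using poly_fun_deg_le_mono[OF F(2) n]
    by (simp add: poly_map_deg_le_def comp_def elementary_henon_def case_prod_beta)
qed

lemma poly_fun_deg_le_bound:
  assumes "poly_fun_deg_le n f"
  obtains M where "M \<ge> 0" "\<And>z. cmod (f z) \<le> M * max 1 (sup_norm z) ^ n"
proof -
  obtain c where f: "f = (\<lambda>z. \<Sum>i\<le>n. \<Sum>j\<le>n - i. c i j * (fst z ^ i * snd z ^ j))"
    using assms unfolding poly_fun_deg_le_iff by blast
  show ?thesis
  proof (rule that[of "\<Sum>i\<le>n. \<Sum>j\<le>n - i. cmod (c i j)"])
    show "(\<Sum>i\<le>n. \<Sum>j\<le>n - i. cmod (c i j)) \<ge> 0" by (intro sum_nonneg) auto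
    fix z
    define t where "t = max 1 (sup_norm z)"
    have t: "t \<ge> 1" "cmod (fst z) \<le> t" "cmod (snd z) \<le> t" by (auto simp: t_def sup_norm_def)
    have "cmod (f z) \<le> (\<Sum>i\<le>n. \<Sum>j\<le>n - i. cmod (c i j) * t ^ n)"
      unfolding f
    proof (intro sum_norm_le)
      fix i j assume "i \<in> {..n}" "j \<in> {..n - i}"
      then have "cmod (fst z) ^ i * cmod (snd z) ^ j \<le> t ^ i * t ^ j"
        using t by (intro mult_mono power_mono) auto
      also have "\<dots> \<le> t ^ n"
        using \<open>i \<in> {..n}\<close> \<open>j \<in> {..n - i}\<close> t by (auto simp flip: power_add intro!: power_increasing)
      finally show "cmod (c i j * (fst z ^ i * snd z ^ j)) \<le> cmod (c i j) * t ^ n"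
        by (simp add: norm_mult norm_power mult_left_mono)
    qed
    then show "cmod (f z) \<le> (\<Sum>i\<le>n. \<Sum>j\<le>n - i. cmod (c i j)) * max 1 (sup_norm z) ^ n"
      by (simp add: sum_distrib_right t_def)
  qed
qed

lemma poly_map_deg_le_growth:
  assumes "poly_map_deg_le n F"
  obtains C where "\<And>z. log_norm (F z) \<le> real n * log_norm z + C"
proof -
  obtain M\<^sub>1 M\<^sub>2 where M: "M\<^sub>1 \<ge> 0" "\<And>z. cmod (fst (F z)) \<le> M\<^sub>1 * max 1 (sup_norm z) ^ n"
    "M\<^sub>2 \<ge> 0" "\<And>z. cmod (snd (F z)) \<le> M\<^sub>2 * max 1 (sup_norm z) ^ n"
    using assms poly_fun_deg_le_bound unfolding poly_map_deg_le_def comp_def by metis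
  show ?thesis
  proof (rule that)
    fix z
    define t where "t = max 1 (sup_norm z)"
    have t: "t \<ge> 1" "t ^ n \<ge> 1" by (auto simp: t_def one_le_power)
    have "cmod (fst (F z)) \<le> M\<^sub>1 * t ^ n" "cmod (snd (F z)) \<le> M\<^sub>2 * t ^ n"
      using M by (auto simp: t_def)
    moreover have "0 \<le> M\<^sub>1 * t ^ n" "0 \<le> M\<^sub>2 * t ^ n" using M t by auto
    ultimately have "max 1 (sup_norm (F z)) \<le> (1 + M\<^sub>1 + M\<^sub>2) * t ^ n"
      using t(2) unfolding sup_norm_def by (simp add: algebra_simps)
    then have "log_norm (F z) \<le> ln ((1 + M\<^sub>1 + M\<^sub>2) * t ^ n)"
      unfolding log_norm_eq by (intro ln_mono) auto
    also have "\<dots> = real n * log_norm z + ln (1 + M\<^sub>1 + M\<^sub>2)"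
      using M t by (simp add: ln_mult ln_realpow log_norm_eq t_def)
    finally show "log_norm (F z) \<le> real n * log_norm z + ln (1 + M\<^sub>1 + M\<^sub>2)" .
  qed
qed

text \<open>A representation of degree \<open>n\<close> forces logarithmic growth of rate at most
  \<open>n\<close>, while on the vertical region the rate is at least \<open>d\<close>. For
  \<open>n < d\<close> these contradict each other far out on the vertical axis.\<close>

lemma map_degree_eq:
  assumes F: "poly_map_deg_le d F" "growth_bound R\<^sub>0 C d F"
  shows "map_degree F = d"
  unfolding map_degree_def
proof (rule Least_equality)
  show "poly_fun_deg_le d (fst \<circ> F) \<and> poly_fun_deg_le d (snd \<circ> F)"
    using F(1) by (simp add: poly_map_deg_le_def)
  fix n assume "poly_fun_deg_le n (fst \<circ> F) \<and> poly_fun_deg_le n (snd \<circ> F)"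
  then obtain C' where C': "\<And>z. log_norm (F z) \<le> real n * log_norm z + C'"
    using poly_map_deg_le_growth unfolding poly_map_deg_le_def by blast
  show "d \<le> n"
  proof (rule ccontr)
    assume "\<not> d \<le> n"
    then have dn: "real d \<ge> real n + 1" by linarith
    \<comment> \<open>\<open>L \<ge> 0\<close> yields \<open>log_norm z = L\<close>,
      \<open>L \<ge> R\<^sub>0\<close> puts \<open>z\<close> into the region because
      \<open>exp L \<ge> L\<close>, and the last entry exceeds what the two error terms
      allow.\<close>
    define L where "L = max 0 (max R\<^sub>0 (C + C' + 1))"
    define z :: C2 where "z = (0, of_real (exp L))"
    have L: "log_norm z = L" by (simp add: log_norm_eq z_def sup_norm_def L_def max_def)
    have "R\<^sub>0 \<le> exp L"
    proof (rule order_trans)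
      show "R\<^sub>0 \<le> L" by (simp add: L_def)
      show "L \<le> exp L" using exp_ge_add_one_self[of L] by linarith
    qed
    then have "z \<in> vertical_region R\<^sub>0" by (simp add: vertical_region_def z_def)
    then have "real d * L \<le> real n * L + C' + C"
      using growth_boundD(3)[OF F(2), of R\<^sub>0 z] C'[of z] L by simp
    moreover have "(real n + 1) * L \<le> real d * L" using dn by (intro mult_right_mono) (auto simp: L_def)
    ultimately have "L \<le> C' + C" by (simp add: algebra_simps)
    then show False by (simp add: L_def)
  qed
qed

section \<open>Compositions of elementary maps: degrees and inverses\<close>

definition henon_comp :: "(complex poly \<times> complex) list \<Rightarrow> C2 \<Rightarrow> C2" where
  "henon_comp ps = compose_list (map (\<lambda>(p, a). elementary_henon p a) ps)"

lemma henon_mapE: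
  assumes "henon_map H"
  obtains ps where "ps \<noteq> []" "H = henon_comp ps" "\<And>p a. (p, a) \<in> set ps \<Longrightarrow> degree p \<ge> 2 \<and> a \<noteq> 0"
proof -
  obtain Hs where Hs: "Hs \<noteq> []" "H = compose_list Hs"
    "\<forall>h\<in>set Hs. \<exists>p a. degree p \<ge> 2 \<and> a \<noteq> 0 \<and> h = elementary_henon p a"
    using assms unfolding henon_map_def by blast
  then obtain P A where PA: "\<And>h. h \<in> set Hs \<Longrightarrow> degree (P h) \<ge> 2 \<and> A h \<noteq> 0 \<and> h = elementary_henon (P h) (A h)"
    by metis
  have "map (\<lambda>(p, a). elementary_henon p a) (map (\<lambda>h. (P h, A h)) Hs) = Hs"
    using PA by (simp add: map_idI comp_def)
  then show ?thesis
    by (intro that[of "map (\<lambda>h. (P h, A h)) Hs"]) (use Hs(1,2) PA henon_comp_def in auto)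
qed

text \<open>The polynomial upper bound and the growth estimate are proved with the same number,
  which is what the identification of \<open>map_degree\<close> needs. The bound by 1 covers the
  empty tail in the induction.\<close>

lemma henon_comp_bounds:
  assumes "\<And>p a. (p, a) \<in> set ps \<Longrightarrow> degree p \<ge> 2"
  shows "poly_map_deg_le (\<Prod>(p, a)\<leftarrow>ps. degree p) (henon_comp ps) \<and>
         (\<exists>R\<^sub>0 C. growth_bound R\<^sub>0 C (\<Prod>(p, a)\<leftarrow>ps. degree p) (henon_comp ps)) \<and>
         (ps \<noteq> [] \<longrightarrow> (\<Prod>(p, a)\<leftarrow>ps. degree p) \<ge> 2) \<and> (\<Prod>(p, a)\<leftarrow>ps. degree p) \<ge> 1"
  using assms
proof (induction ps)
  case Nil
  have "henon_comp [] = id" by (simp add: henon_comp_def)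
  then have "poly_map_deg_le 1 (henon_comp [])" "growth_bound 0 0 1 (henon_comp [])"
    by (simp_all only: poly_map_deg_le_id growth_bound_id)
  then show ?case by auto
next
  case (Cons q ps)
  obtain p a where q: "q = (p, a)" by fastforce
  let ?d = "\<Prod>(p, a)\<leftarrow>ps. degree p"
  have p: "degree p \<ge> 2" by (rule Cons.prems[of p a]) (simp add: q)
  have IH: "poly_map_deg_le ?d (henon_comp ps)" "\<exists>R\<^sub>0 C. growth_bound R\<^sub>0 C ?d (henon_comp ps)" "?d \<ge> 1"
    using Cons by auto
  have eq: "henon_comp (q # ps) = elementary_henon p a \<circ> henon_comp ps"
    by (simp add: henon_comp_def q)
  have "\<exists>R\<^sub>0 C. growth_bound R\<^sub>0 C (degree p * ?d) (henon_comp (q # ps))"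
    unfolding eq using elementary_henon_growth[OF p, of a] IH(2) growth_bound_compose by blast
  moreover have "poly_map_deg_le (degree p * ?d) (henon_comp (q # ps))"
    unfolding eq using IH(1) p by (intro poly_map_deg_le_elementary_henon) auto
  moreover have "degree p * ?d \<ge> 2 * 1" using p IH(3) by (intro mult_mono) auto
  ultimately show ?case using p IH(3) by (auto simp: q Suc_le_eq)
qed

lemma map_degree_henon_comp:
  assumes "\<And>p a. (p, a) \<in> set ps \<Longrightarrow> degree p \<ge> 2"
  shows "map_degree (henon_comp ps) = (\<Prod>(p, a)\<leftarrow>ps. degree p)"
proof -
  have "poly_map_deg_le (\<Prod>(p, a)\<leftarrow>ps. degree p) (henon_comp ps) \<and>
      (\<exists>R\<^sub>0 C. growth_bound R\<^sub>0 C (\<Prod>(p, a)\<leftarrow>ps. degree p) (henon_comp ps))"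
    using henon_comp_bounds[of ps] assms by auto
  then show ?thesis by (elim conjE exE) (rule map_degree_eq)
qed

lemma henon_map_growth:
  assumes "henon_map H"
  shows "map_degree H \<ge> 2" "\<exists>R\<^sub>0 C. growth_bound R\<^sub>0 C (map_degree H) H"
proof -
  obtain ps where ps: "ps \<noteq> []" "H = henon_comp ps" "\<And>p a. (p, a) \<in> set ps \<Longrightarrow> degree p \<ge> 2"
    using henon_mapE[OF assms] by metis
  show "map_degree H \<ge> 2" "\<exists>R\<^sub>0 C. growth_bound R\<^sub>0 C (map_degree H) H"
    using henon_comp_bounds[OF ps(3)] ps(1) by (auto simp: ps(2) map_degree_henon_comp[OF ps(3)])
qed

text \<open>The inverse of a Henon map has the wrong shape (its first coordinate is the polynomial one);
  conjugation with the coordinate swap turns it into a Henon map, which reduces \<open>green_minus\<close> to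
  \<open>green_plus\<close>.\<close>

definition swap_inverse :: "(C2 \<Rightarrow> C2) \<Rightarrow> C2 \<Rightarrow> C2" where
  "swap_inverse f = prod.swap \<circ> inv f \<circ> prod.swap"

text \<open>Solving \<open>u = y\<close>, \<open>v = poly p y - a * x\<close> gives
  \<open>x = (poly p u - v) / a\<close> and \<open>y = u\<close>. After swapping source and target
  this is an elementary map with data \<open>p / a\<close> and \<open>1 / a\<close>.\<close>

lemma elementary_henon_bij_swap_inverse:
  assumes "a \<noteq> 0"
  shows "bij (elementary_henon p a)"
    and "swap_inverse (elementary_henon p a) = elementary_henon (smult (1 / a) p) (1 / a)"
proof -
  let ?g = "prod.swap \<circ> elementary_henon (smult (1 / a) p) (1 / a) \<circ> prod.swap"
  have 1: "elementary_henon p a \<circ> ?g = id" and 2: "?g \<circ> elementary_henon p a = id"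
    using assms by (auto simp: fun_eq_iff elementary_henon_def field_simps)
  show "bij (elementary_henon p a)" by (rule o_bij[OF 2 1])
  show "swap_inverse (elementary_henon p a) = elementary_henon (smult (1 / a) p) (1 / a)"
    unfolding swap_inverse_def inv_unique_comp[OF 1 2] by (simp add: fun_eq_iff)
qed

lemma bij_compose_list:
  assumes "\<And>f. f \<in> set fs \<Longrightarrow> bij f"
  shows "bij (compose_list fs)"
  using assms by (induction fs) (auto intro: bij_comp)

text \<open>Inversion reverses the order of the factors, and the two swaps meeting between
  neighbouring factors cancel.\<close>

lemma swap_inverse_compose_list:
  assumes "\<And>f. f \<in> set fs \<Longrightarrow> bij f"
  shows "swap_inverse (compose_list fs) = compose_list (rev (map swap_inverse fs))"
  using assms
proof (induction fs)
  case Nil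
  then show ?case by (simp add: swap_inverse_def fun_eq_iff inv_id)
next
  case (Cons f fs)
  have "inv (f \<circ> compose_list fs) = inv (compose_list fs) \<circ> inv f"
    using Cons.prems by (intro o_inv_distrib bij_compose_list) auto
  then have "swap_inverse (f \<circ> compose_list fs) = swap_inverse (compose_list fs) \<circ> swap_inverse f"
    by (simp add: swap_inverse_def fun_eq_iff)
  moreover have "swap_inverse (compose_list fs) = compose_list (rev (map swap_inverse fs))"
    using Cons by simp
  moreover have "compose_list (rev (map swap_inverse (f # fs))) =
      compose_list (rev (map swap_inverse fs)) \<circ> swap_inverse f"
    by (simp add: compose_list_append)
  ultimately show ?case by (simp only: compose_list_Cons)
qed

lemma henon_map_swap_inverse:
  assumes "henon_map H"
  shows "bij H" "henon_map (swap_inverse H)" "map_degree (swap_inverse H) = map_degree H"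
proof -
  obtain ps where ps: "ps \<noteq> []" "H = henon_comp ps" "\<And>p a. (p, a) \<in> set ps \<Longrightarrow> degree p \<ge> 2 \<and> a \<noteq> 0"
    using henon_mapE[OF assms] by metis
  \<comment> \<open>Scaling by the nonzero \<open>1 / a\<close> keeps each degree and reversal keeps
    their product, so the degree of the map is preserved.\<close>
  define qs where "qs = rev (map (\<lambda>(p, a). (smult (1 / a) p, 1 / a)) ps)"
  have bij: "f \<in> set (map (\<lambda>(p, a). elementary_henon p a) ps) \<Longrightarrow> bij f" for f
    using ps(3) elementary_henon_bij_swap_inverse(1) by auto
  show "bij H" unfolding ps(2) henon_comp_def by (rule bij_compose_list[OF bij])
  have "map (swap_inverse \<circ> (\<lambda>(p, a). elementary_henon p a)) ps
      = map ((\<lambda>(p, a). elementary_henon p a) \<circ> (\<lambda>(p, a). (smult (1 / a) p, 1 / a))) ps"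
    using ps(3) elementary_henon_bij_swap_inverse(2) by (intro map_cong) auto
  moreover have "swap_inverse H = compose_list (rev (map swap_inverse (map (\<lambda>(p, a). elementary_henon p a) ps)))"
    unfolding ps(2) henon_comp_def by (rule swap_inverse_compose_list) (rule bij)
  ultimately have eq: "swap_inverse H = henon_comp qs"
    unfolding henon_comp_def by (simp only: qs_def map_map flip: rev_map)
  have qs: "degree p \<ge> 2 \<and> a \<noteq> 0" if "(p, a) \<in> set qs" for p a
    using that ps(3) by (auto simp: qs_def)
  show "henon_map (swap_inverse H)"
    unfolding henon_map_def
  proof (intro exI conjI)
    show "swap_inverse H = compose_list (map (\<lambda>(p, a). elementary_henon p a) qs)"
      by (simp add: eq henon_comp_def)
    show "map (\<lambda>(p, a). elementary_henon p a) qs \<noteq> []" using ps(1) by (simp add: qs_def)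
    show "\<forall>h\<in>set (map (\<lambda>(p, a). elementary_henon p a) qs).
        \<exists>p a. degree p \<ge> 2 \<and> a \<noteq> 0 \<and> h = elementary_henon p a"
      using qs by auto
  qed
  have "map ((\<lambda>(p, a). degree p) \<circ> (\<lambda>(p, a). (smult (1 / a) p, 1 / a))) ps = map (\<lambda>(p, a). degree p) ps"
    using ps(3) by (intro map_cong) auto
  then have "(\<Prod>(p, a)\<leftarrow>qs. degree p) = (\<Prod>(p, a)\<leftarrow>ps. degree p)"
    by (simp only: qs_def map_map prod_list.rev flip: rev_map)
  then show "map_degree (swap_inverse H) = map_degree H"
    using map_degree_henon_comp[of qs] map_degree_henon_comp[of ps] qs ps(2,3) eq by metis
qed

section \<open>Sub-mean values on complex lines\<close>

text \<open>Continuity is built in so that every circle integral exists, and the Henstock-Kurzweil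
  integral suits uniform limits. The passage to the Lebesgue integral of
  \<open>subharmonic_on\<close> is made once, after the limit.\<close>

definition circle_submean :: "(complex \<Rightarrow> real) \<Rightarrow> bool" where
  "circle_submean u \<longleftrightarrow> continuous_on UNIV u \<and>
     (\<forall>a r. r > 0 \<longrightarrow> 2 * pi * u a \<le> integral {0..2*pi} (\<lambda>t. u (a + of_real r * cis t)))"

lemma continuous_on_circle:
  assumes "continuous_on UNIV u"
  shows "continuous_on S (\<lambda>t. u (a + of_real r * cis t))"
  by (intro continuous_intros continuous_on_compose2[OF assms]) auto

lemma integrable_on_circle:
  fixes u :: "complex \<Rightarrow> real"
  assumes "continuous_on UNIV u"
  shows "(\<lambda>t. u (a + of_real r * cis t)) integrable_on {0..2*pi}"
  by (intro integrable_continuous_interval continuous_on_circle assms)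

lemma circle_submean_scale:
  assumes "circle_submean u" "c \<ge> 0"
  shows "circle_submean (\<lambda>s. c * u s)"
proof -
  have "2 * pi * (c * u a) \<le> c * integral {0..2*pi} (\<lambda>t. u (a + of_real r * cis t))" if "r > 0" for a r
  proof -
    have "c * (2 * pi * u a) \<le> c * integral {0..2*pi} (\<lambda>t. u (a + of_real r * cis t))"
      using assms that by (intro mult_left_mono) (auto simp: circle_submean_def)
    then show ?thesis by (simp only: mult.left_commute)
  qed
  then show ?thesis using assms by (auto simp: circle_submean_def intro!: continuous_intros)
qed

lemma circle_submean_sum:
  assumes "finite A" "\<And>k. k \<in> A \<Longrightarrow> circle_submean (f k)"
  shows "circle_submean (\<lambda>s. \<Sum>k\<in>A. f k s)"
  unfolding circle_submean_def
proof (intro conjI allI impI)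
  show "continuous_on UNIV (\<lambda>s. \<Sum>k\<in>A. f k s)"
    using assms by (auto intro!: continuous_intros simp: circle_submean_def)
  fix a :: complex and r :: real assume "r > 0"
  then have "2 * pi * (\<Sum>k\<in>A. f k a) \<le> (\<Sum>k\<in>A. integral {0..2*pi} (\<lambda>t. f k (a + of_real r * cis t)))"
    unfolding sum_distrib_left using assms(2) by (intro sum_mono) (auto simp: circle_submean_def)
  also have "\<dots> = integral {0..2*pi} (\<lambda>t. \<Sum>k\<in>A. f k (a + of_real r * cis t))"
    using assms by (intro integral_sum[symmetric] integrable_on_circle) (auto simp: circle_submean_def)
  finally show "2 * pi * (\<Sum>k\<in>A. f k a) \<le> integral {0..2*pi} (\<lambda>t. \<Sum>k\<in>A. f k (a + of_real r * cis t))" .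
qed

lemma circle_submean_uniform_limit:
  fixes u :: "nat \<Rightarrow> complex \<Rightarrow> real"
  assumes sub: "\<And>k. circle_submean (u k)"
    and lim: "\<And>R. uniform_limit (cball 0 R) u v sequentially"
  shows "circle_submean v"
  unfolding circle_submean_def
proof (intro conjI allI impI)
  have "continuous_on (ball 0 R) v" for R
    by (rule uniform_limit_theorem[OF always_eventually uniform_limit_on_subset[OF lim[of R]]])
       (use sub in \<open>auto simp: circle_submean_def intro: continuous_on_subset\<close>)
  then have "continuous_on (\<Union>R\<in>UNIV. ball 0 R) v" by (intro continuous_on_open_UN) auto
  moreover have "(\<Union>R\<in>UNIV. ball 0 R) = (UNIV :: complex set)"
    using gt_ex by auto
  ultimately show "continuous_on UNIV v" by simp
  fix a :: complex and r :: real assume r: "r > 0"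
  let ?c = "\<lambda>t. a + of_real r * cis t"
  \<comment> \<open>This disc about 0 contains the whole circle, so the local uniform convergence
    applies along it and the integrals converge.\<close>
  have "?c \<in> {0..2*pi} \<rightarrow> cball 0 (cmod a + r)"
    using r by (auto intro!: order_trans[OF norm_triangle_ineq] simp: norm_mult)
  then have "uniform_limit {0..2*pi} (\<lambda>k t. u k (?c t)) (\<lambda>t. v (?c t)) sequentially"
    by (rule uniform_limit_compose'[OF lim])
  then obtain I J where IJ: "\<And>k. ((\<lambda>t. u k (?c t)) has_integral I k) {0..2*pi}"
      "((\<lambda>t. v (?c t)) has_integral J) {0..2*pi}" "I \<longlonglongrightarrow> J"
  proof (rule uniform_limit_integral)
    show "continuous_on {0..2*pi} (\<lambda>t. u k (?c t))" for k
      using sub by (intro continuous_on_circle) (auto simp: circle_submean_def)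
  qed auto
  have "(\<lambda>k. 2 * pi * u k a) \<longlonglongrightarrow> 2 * pi * v a"
    by (intro tendsto_intros tendsto_uniform_limitI[OF lim[of "cmod a"]]) auto
  moreover have "2 * pi * u k a \<le> I k" for k
    using sub[of k] r integral_unique[OF IJ(1)] unfolding circle_submean_def by metis
  ultimately have "2 * pi * v a \<le> J" using LIMSEQ_le[OF _ IJ(3)] by blast
  then show "2 * pi * v a \<le> integral {0..2*pi} (\<lambda>t. v (?c t))" using integral_unique[OF IJ(2)] by simp
qed

lemma continuous_imp_upper_semicontinuous_on:
  assumes "continuous_on S u"
  shows "upper_semicontinuous_on S u"
  using assms unfolding upper_semicontinuous_on_def continuous_on_def
  by (auto intro: order_tendstoD(2))

lemma circle_submean_imp_subharmonic:
  assumes u: "circle_submean u"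
  shows "subharmonic_on UNIV u"
  unfolding subharmonic_on_def
proof (intro conjI allI impI)
  have cont: "continuous_on UNIV u" using u by (simp add: circle_submean_def)
  then show "upper_semicontinuous_on UNIV u" by (rule continuous_imp_upper_semicontinuous_on)
  fix a :: complex and r :: real assume r: "r > 0"
  let ?f = "\<lambda>t. u (a + of_real r * cis t)"
  show int: "set_integrable lborel {0..2 * pi} ?f"
    by (intro borel_integrable_atLeastAtMost' continuous_on_circle cont)
  have "2 * pi * u a \<le> (LBINT t:{0..2 * pi}. ?f t)"
    using u r set_borel_integral_eq_integral(2)[OF int] by (simp add: circle_submean_def)
  then show "u a \<le> (LBINT t:{0..2 * pi}. ?f t) / (2 * pi)" by (simp add: field_simps)
qed auto

definition holomorphic_curve :: "(complex \<Rightarrow> C2) \<Rightarrow> bool" where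
  "holomorphic_curve \<gamma> \<longleftrightarrow> (\<lambda>s. fst (\<gamma> s)) holomorphic_on UNIV \<and> (\<lambda>s. snd (\<gamma> s)) holomorphic_on UNIV"

text \<open>Holomorphy is tested along curves: the property is visibly closed under composition, and
  it turns complex lines into curves on which one-variable theory applies.\<close>

definition entire_map :: "(C2 \<Rightarrow> C2) \<Rightarrow> bool" where
  "entire_map F \<longleftrightarrow> continuous_on UNIV F \<and> (\<forall>\<gamma>. holomorphic_curve \<gamma> \<longrightarrow> holomorphic_curve (F \<circ> \<gamma>))"

lemma holomorphic_curve_complex_line: "holomorphic_curve (complex_line a b)"
  by (auto simp: holomorphic_curve_def complex_line_def intro!: holomorphic_intros)

lemma continuous_log_norm: "continuous_on UNIV log_norm"
  unfolding log_norm_eq sup_norm_def by (intro continuous_intros) (auto simp: max_def)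

text \<open>\<open>exp (log_norm (\<gamma> s))\<close> is the largest of the moduli of three entire
  functions: the two coordinates and the constant 1. Each modulus at \<open>a\<close> is at most the
  exponential of the circle mean, hence so is their maximum.\<close>

lemma circle_submean_log_norm:
  assumes "holomorphic_curve \<gamma>"
  shows "circle_submean (\<lambda>s. log_norm (\<gamma> s))"
  unfolding circle_submean_def
proof (intro conjI allI impI)
  let ?u = "\<lambda>s. log_norm (\<gamma> s)"
  have hol: "(\<lambda>s. fst (\<gamma> s)) holomorphic_on UNIV" "(\<lambda>s. snd (\<gamma> s)) holomorphic_on UNIV"
    using assms by (auto simp: holomorphic_curve_def)
  then have "continuous_on UNIV (\<lambda>s. (fst (\<gamma> s), snd (\<gamma> s)))"
    by (intro continuous_intros holomorphic_on_imp_continuous_on)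
  then show cont: "continuous_on UNIV ?u"
    using continuous_on_compose2[OF continuous_log_norm] by simp
  fix a :: complex and r :: real assume r: "r > 0"
  define M where "M = integral {0..2*pi} (\<lambda>t. ?u (a + of_real r * cis t))"
  have le: "cmod (fst (\<gamma> s)) \<le> exp (?u s)" "cmod (snd (\<gamma> s)) \<le> exp (?u s)" "cmod 1 \<le> exp (?u s)" for s
    by (auto simp: exp_log_norm sup_norm_def)
  have "cmod (fst (\<gamma> a)) \<le> exp (M / (2 * pi))" "cmod (snd (\<gamma> a)) \<le> exp (M / (2 * pi))"
    "cmod 1 \<le> exp (M / (2 * pi))"
    unfolding M_def
    by (rule norm_le_exp_circle_mean[OF hol(1) cont le(1) r]
             norm_le_exp_circle_mean[OF hol(2) cont le(2) r]
             norm_le_exp_circle_mean[OF holomorphic_on_const cont le(3) r])+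
  then have "?u a \<le> M / (2 * pi)" by (simp add: log_norm_le_iff sup_norm_def)
  then show "2 * pi * ?u a \<le> M" by (simp add: field_simps)
qed

lemma entire_map_elementary_henon: "entire_map (elementary_henon p a)"
  unfolding entire_map_def holomorphic_curve_def elementary_henon_def poly_altdef
  by (auto simp: case_prod_beta intro!: continuous_intros holomorphic_intros)

lemma entire_map_compose_list:
  assumes "\<And>f. f \<in> set fs \<Longrightarrow> entire_map f"
  shows "entire_map (compose_list fs)"
  using assms
proof (induction fs)
  case Nil
  then show ?case by (simp add: entire_map_def comp_def id_def)
next
  case (Cons f fs)
  then have "entire_map f" "entire_map (compose_list fs)" by auto
  then have "entire_map (f \<circ> compose_list fs)"
    unfolding entire_map_def by (auto intro: continuous_on_compose2[of UNIV f] simp: comp_assoc)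
  then show ?case by (simp only: compose_list_Cons)
qed

lemma entire_map_henon_map: "henon_map H \<Longrightarrow> entire_map H"
  unfolding henon_map_def using entire_map_compose_list entire_map_elementary_henon by metis

section \<open>Convergence\<close>

lemma words_0: "words n 0 = {[]}"
  by (auto simp: words_def)

lemma words_Suc: "words n (Suc k) = (\<lambda>(i, w). i # w) ` ({1..n} \<times> words n k)"
  by (auto simp: words_def length_Suc_conv image_iff)

lemma finite_words: "finite (words n k)"
  by (induction k) (auto simp: words_0 words_Suc)

text \<open>The letter split off is the outermost map, so the longer words apply one more map to the
  points reached by the shorter ones.\<close>

lemma sum_words_Suc: "(\<Sum>w\<in>words n (Suc k). f w) = (\<Sum>w\<in>words n k. \<Sum>i=1..n. f (i # w))"
proof -
  have "(\<Sum>w\<in>words n (Suc k). f w) = (\<Sum>(i, w)\<in>{1..n} \<times> words n k. f (i # w))"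
    unfolding words_Suc by (subst sum.reindex) (auto simp: inj_on_def case_prod_beta)
  also have "\<dots> = (\<Sum>w\<in>words n k. \<Sum>i=1..n. f (i # w))"
    by (simp add: sum.swap[of _ "words n k"] flip: sum.cartesian_product)
  finally show ?thesis .
qed

lemma card_words: "card (words n k) = n ^ k"
  by (induction k) (simp_all add: words_0 words_Suc card_image inj_on_def card_cartesian_product)

lemma sum_words_rev: "(\<Sum>w\<in>words n k. f (rev w)) = (\<Sum>w\<in>words n k. f w)"
  by (rule sum.reindex_bij_witness[of _ rev rev]) (auto simp: words_def)

text \<open>\<open>R\<^sub>0\<close> and \<open>C\<close> are common to all maps, so that orbits
  under mixed words are followed with a single region.\<close>

locale growth_family =
  fixes n :: nat and d :: "nat \<Rightarrow> nat" and F :: "nat \<Rightarrow> C2 \<Rightarrow> C2" and R\<^sub>0 C :: real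
  assumes n_pos: "n \<ge> 1"
    and degree: "i \<in> {1..n} \<Longrightarrow> d i \<ge> 2"
    and growth: "i \<in> {1..n} \<Longrightarrow> growth_bound R\<^sub>0 C (d i) (F i)"
    and entire: "i \<in> {1..n} \<Longrightarrow> entire_map (F i)"
begin

definition total :: nat where
  "total = (\<Sum>i=1..n. d i)"

definition average :: "nat \<Rightarrow> C2 \<Rightarrow> real" where
  "average k z = (\<Sum>w\<in>words n k. log_norm (compose_list (map F w) z)) / real total ^ k"

lemma total_ge: "total \<ge> 2 * n"
  using sum_mono[of "{1..n}" "\<lambda>_. 2" d] degree by (simp add: total_def)

lemma entire_word:
  assumes "w \<in> words n k"
  shows "entire_map (compose_list (map F w))"
  using assms entire by (intro entire_map_compose_list) (auto simp: words_def)

lemma continuous_average: "continuous_on UNIV (average k)"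
  unfolding average_def using entire_word
  by (intro continuous_intros continuous_on_compose2[OF continuous_log_norm])
     (use total_ge n_pos in \<open>auto simp: entire_map_def\<close>)

lemma circle_submean_average:
  assumes "holomorphic_curve \<gamma>"
  shows "circle_submean (\<lambda>s. average k (\<gamma> s))"
proof -
  have "circle_submean (\<lambda>s. inverse (real total ^ k) * (\<Sum>w\<in>words n k. log_norm ((compose_list (map F w) \<circ> \<gamma>) s)))"
    by (intro circle_submean_scale circle_submean_sum circle_submean_log_norm finite_words)
       (use assms entire_word in \<open>auto simp: entire_map_def comp_def\<close>)
  then show ?thesis by (simp add: average_def divide_inverse mult.commute)
qed

text \<open>Each of the \<open>n ^ k\<close> words contributes at most a constant \<open>B\<close>
  fixed by \<open>r\<close> and the family, and the common denominator is
  \<open>total ^ Suc k\<close>.\<close>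

lemma average_diff_le:
  obtains K where "\<And>k z. sup_norm z \<le> r \<Longrightarrow>
    \<bar>average (Suc k) z - average k z\<bar> \<le> K * (real n / real total) ^ k"
proof -
  define \<rho> where "\<rho> = max r R\<^sub>0"
  define L where "L = ln (max 1 \<rho>)"
  \<comment> \<open>On the region each map errs by at most \<open>C\<close>. Elsewhere the orbit
    point has norm at most \<open>\<rho>\<close>, so \<open>d i * log_norm y\<close> is itself at
    most \<open>d i * L\<close>.\<close>
  define B where "B = (\<Sum>i=1..n. real (d i) * L + C)"
  have step: "\<bar>(\<Sum>i=1..n. log_norm (F i y)) - real total * log_norm y\<bar> \<le> B"
    if y: "y \<in> vertical_region R\<^sub>0 \<or> sup_norm y \<le> \<rho>" for y
  proof -
    have L0: "L \<ge> 0" by (simp add: L_def)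
    have "\<bar>log_norm (F i y) - real (d i) * log_norm y\<bar> \<le> real (d i) * L + C" if i: "i \<in> {1..n}" for i
    proof -
      note g = growth_boundD[OF growth[OF i]]
      have dL: "0 \<le> real (d i) * L" using L0 by simp
      show ?thesis
      proof (cases "y \<in> vertical_region R\<^sub>0")
        case True
        then show ?thesis using g(1)[of y] g(3)[of R\<^sub>0 y] dL by (auto simp: abs_le_iff)
      next
        case False
        then have "log_norm y \<le> L" using y unfolding log_norm_eq L_def by (intro ln_mono) auto
        then have "real (d i) * log_norm y \<le> real (d i) * L" by (intro mult_left_mono) auto
        moreover have "0 \<le> log_norm (F i y)" "0 \<le> C + real (d i) * log_norm y"
          using g(1)[of y] log_norm_nonneg[of "F i y"] by linarith+
        \<comment> \<open>At any point of the region the upper and the lower estimate both hold, and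
          together they give \<open>0 \<le> 2 * C\<close>.\<close>
        moreover have "C \<ge> 0"
        proof -
          define q :: C2 where "q = (0, of_real (max 1 R\<^sub>0))"
          have "q \<in> vertical_region R\<^sub>0" by (simp add: q_def vertical_region_def)
          then show ?thesis using g(1)[of q] g(3)[of R\<^sub>0 q] by simp
        qed
        ultimately show ?thesis using g(1)[of y] dL unfolding abs_le_iff by (intro conjI; linarith)
      qed
    qed
    then have "\<bar>\<Sum>i=1..n. log_norm (F i y) - real (d i) * log_norm y\<bar> \<le> B"
      unfolding B_def by (intro order_trans[OF sum_abs sum_mono]) auto
    moreover have "real total * log_norm y = (\<Sum>i=1..n. real (d i) * log_norm y)"
      by (simp add: total_def sum_distrib_right)
    ultimately show ?thesis by (simp only: sum_subtractf)
  qed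
  have D: "real total > 0" using total_ge n_pos by linarith
  show ?thesis
  proof (rule that[of "B / real total"])
    fix k z assume z: "sup_norm z \<le> r"
    have orbit: "compose_list (map F w) z \<in> vertical_region R\<^sub>0 \<or> sup_norm (compose_list (map F w) z) \<le> \<rho>"
      if "w \<in> words n k" for w
    proof -
      have "compose_list (map F w) z \<in> vertical_region R\<^sub>0 \<or>
          sup_norm (compose_list (map F w) z) \<le> max (sup_norm z) R\<^sub>0"
      proof (rule compose_list_dichotomy[where C = C])
        fix f assume "f \<in> set (map F w)"
        then obtain i where "i \<in> set w" "f = F i" by auto
        moreover from this have "i \<in> {1..n}" using that by (auto simp: words_def)
        ultimately show "\<exists>d. growth_bound R\<^sub>0 C d f" using growth by blast
      qed simp
      then show ?thesis using z by (auto simp: \<rho>_def)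
    qed
    let ?l = "\<lambda>w. log_norm (compose_list (map F w) z)"
    let ?S = "\<lambda>w. \<Sum>i=1..n. log_norm (F i (compose_list (map F w) z))"
    have "average (Suc k) z = (\<Sum>w\<in>words n k. ?S w) / real total ^ Suc k"
      by (simp add: average_def sum_words_Suc)
    moreover have "average k z = (\<Sum>w\<in>words n k. real total * ?l w) / real total ^ Suc k"
      using D by (simp add: average_def flip: sum_distrib_left)
    ultimately have "average (Suc k) z - average k z =
        (\<Sum>w\<in>words n k. ?S w - real total * ?l w) / real total ^ Suc k"
      by (simp only: sum_subtractf diff_divide_distrib)
    also have "\<bar>\<dots>\<bar> = \<bar>\<Sum>w\<in>words n k. ?S w - real total * ?l w\<bar> / real total ^ Suc k"
      using D by (simp only: abs_divide abs_of_pos zero_less_power)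
    also have "\<dots> \<le> (\<Sum>w\<in>words n k. B) / real total ^ Suc k"
    proof (rule divide_right_mono)
      show "\<bar>\<Sum>w\<in>words n k. ?S w - real total * ?l w\<bar> \<le> (\<Sum>w\<in>words n k. B)"
        by (rule order_trans[OF sum_abs sum_mono]) (rule step[OF orbit])
    qed simp
    also have "\<dots> = B / real total * (real n / real total) ^ k"
      by (simp add: card_words power_divide mult.commute)
    finally show "\<bar>average (Suc k) z - average k z\<bar> \<le> B / real total * (real n / real total) ^ k" .
  qed
qed

definition limit :: "C2 \<Rightarrow> real" where
  "limit z = average 0 z + (\<Sum>k. average (Suc k) z - average k z)"

lemma uniform_limit_average: "uniform_limit {z. sup_norm z \<le> r} average limit sequentially"
proof -
  obtain K where K: "\<And>k z. sup_norm z \<le> r \<Longrightarrow>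
      \<bar>average (Suc k) z - average k z\<bar> \<le> K * (real n / real total) ^ k"
    using average_diff_le by blast
  have "real n < real total" using total_ge n_pos by linarith
  then have "summable (\<lambda>k. K * (real n / real total) ^ k)"
    by (intro summable_mult summable_geometric) simp
  then have "uniform_limit {z. sup_norm z \<le> r} (\<lambda>N z. \<Sum>k<N. average (Suc k) z - average k z)
      (\<lambda>z. \<Sum>k. average (Suc k) z - average k z) sequentially"
    by (intro Weierstrass_m_test[where M = "\<lambda>k. K * (real n / real total) ^ k"]) (use K in auto)
  then have "uniform_limit {z. sup_norm z \<le> r} (\<lambda>N z. average 0 z + (\<Sum>k<N. average (Suc k) z - average k z))
      (\<lambda>z. average 0 z + (\<Sum>k. average (Suc k) z - average k z)) sequentially"
    by (intro uniform_limit_intros)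
  moreover have "average 0 z + (\<Sum>k<N. average (Suc k) z - average k z) = average N z" for N z
    by (induction N) auto
  ultimately show ?thesis by (simp add: limit_def[abs_def])
qed

lemma average_tendsto: "(\<lambda>k. average k z) \<longlonglongrightarrow> limit z"
  by (rule tendsto_uniform_limitI[OF uniform_limit_average[of "sup_norm z"]]) simp

lemma continuous_limit: "continuous_on UNIV limit"
proof -
  \<comment> \<open>Euclidean balls lie in the sup-norm balls where convergence is uniform; open
    ones are chosen because continuity glues along an open cover.\<close>
  have "continuous_on (ball 0 R) limit" for R
  proof (rule uniform_limit_theorem)
    show "uniform_limit (ball 0 R) average limit sequentially"
    proof (rule uniform_limit_on_subset[OF uniform_limit_average[of R]], rule subsetI)
      fix z :: C2 assume "z \<in> ball 0 R"
      then show "z \<in> {z. sup_norm z \<le> R}" using sup_norm_le_norm[of z] by simp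
    qed
    show "\<forall>\<^sub>F k in sequentially. continuous_on (ball 0 R) (average k)"
      using continuous_average continuous_on_subset by (intro always_eventually) blast
  qed auto
  then have "continuous_on (\<Union>R\<in>UNIV. ball 0 R) limit" by (intro continuous_on_open_UN) auto
  moreover have "(\<Union>R\<in>UNIV. ball 0 R) = (UNIV :: C2 set)"
    using gt_ex by auto
  ultimately show ?thesis by simp
qed

lemma circle_submean_limit: "circle_submean (\<lambda>s. limit (complex_line a b s))"
proof (rule circle_submean_uniform_limit)
  show "circle_submean (\<lambda>s. average k (complex_line a b s))" for k
    by (rule circle_submean_average[OF holomorphic_curve_complex_line])
  fix R
  have "complex_line a b \<in> cball 0 R \<rightarrow> {z. sup_norm z \<le> norm a + R * norm b}"
  proof
    fix s assume "s \<in> cball (0 :: complex) R"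
    then have s: "cmod s \<le> R" by simp
    have "cmod (p + s * q) \<le> norm a + R * norm b" if "cmod p \<le> norm a" "cmod q \<le> norm b" for p q
      using norm_triangle_ineq[of p "s * q"] mult_mono[OF s that(2)] that(1) s norm_ge_zero[of s]
      by (simp add: norm_mult)
    then have "cmod (fst a + s * fst b) \<le> norm a + R * norm b" "cmod (snd a + s * snd b) \<le> norm a + R * norm b"
      by (metis norm_fst_le norm_snd_le prod.collapse)+
    then show "complex_line a b s \<in> {z. sup_norm z \<le> norm a + R * norm b}"
      by (simp add: sup_norm_def complex_line_def)
  qed
  then show "uniform_limit (cball 0 R) (\<lambda>k s. average k (complex_line a b s)) (\<lambda>s. limit (complex_line a b s)) sequentially"
    by (rule uniform_limit_compose'[OF uniform_limit_average])
qed

end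

section \<open>Application to Henon maps and their inverses\<close>

lemma continuous_circle_submean_imp_plurisubharmonic:
  assumes "continuous_on UNIV u" "\<And>a b. circle_submean (\<lambda>s. u (complex_line a b s))"
  shows "plurisubharmonic_on UNIV u"
  unfolding plurisubharmonic_on_def comp_def vimage_UNIV
  by (intro conjI allI open_UNIV continuous_imp_upper_semicontinuous_on circle_submean_imp_subharmonic assms)

lemma henon_maps_growth_family:
  assumes "n \<ge> 1" and H: "\<And>i. i \<in> {1..n} \<Longrightarrow> henon_map (H i)"
  obtains R\<^sub>0 C where "growth_family n (\<lambda>i. map_degree (H i)) H R\<^sub>0 C"
proof -
  have "\<forall>i\<in>{1..n}. \<exists>R\<^sub>0 C. growth_bound R\<^sub>0 C (map_degree (H i)) (H i)"
    using H henon_map_growth(2) by blast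
  then obtain R\<^sub>i C\<^sub>i where *: "\<And>i. i \<in> {1..n} \<Longrightarrow> growth_bound (R\<^sub>i i) (C\<^sub>i i) (map_degree (H i)) (H i)"
    by metis
  have "growth_bound (Max (R\<^sub>i ` {1..n})) (Max (C\<^sub>i ` {1..n})) (map_degree (H i)) (H i)" if "i \<in> {1..n}" for i
    by (rule growth_bound_mono[OF *[OF that]]) (use that in \<open>auto intro!: Max_ge\<close>)
  then have "growth_family n (\<lambda>i. map_degree (H i)) H (Max (R\<^sub>i ` {1..n})) (Max (C\<^sub>i ` {1..n}))"
    using assms henon_map_growth(1) entire_map_henon_map by unfold_locales auto
  then show ?thesis by (rule that)
qed

lemma green_plus_limit:
  assumes "n \<ge> 1" "\<And>i. i \<in> {1..n} \<Longrightarrow> henon_map (H i)"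
  obtains G where "\<And>z. (\<lambda>k. green_plus n H k z) \<longlonglongrightarrow> G z" "continuous_on UNIV G"
    "\<And>a b. circle_submean (\<lambda>s. G (complex_line a b s))"
proof -
  obtain R\<^sub>0 C where "growth_family n (\<lambda>i. map_degree (H i)) H R\<^sub>0 C"
    using henon_maps_growth_family[of n H] assms by blast
  then interpret growth_family n "\<lambda>i. map_degree (H i)" H R\<^sub>0 C .
  have "green_plus n H k z = average k z" for k z
    by (simp add: green_plus_def average_def log_norm_def total_def total_degree_def)
  then show ?thesis using that[of limit] average_tendsto continuous_limit circle_submean_limit by simp
qed

text \<open>Up to swaps, the inverse of a word is the reversed word in the conjugated maps. The sup
  norm is invariant under the swap, and reversal permutes the words of length
  \<open>k\<close>.\<close>

lemma green_minus_eq_green_plus: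
  assumes H: "\<And>i. i \<in> {1..n} \<Longrightarrow> henon_map (H i)"
  shows "green_minus n H k z = green_plus n (\<lambda>i. swap_inverse (H i)) k (prod.swap z)"
proof -
  let ?H' = "\<lambda>i. swap_inverse (H i)"
  have deg: "total_degree n ?H' = total_degree n H"
    unfolding total_degree_def using henon_map_swap_inverse(3)[OF H] by (intro sum.cong) auto
  have "log_plus (sup_norm (inv (compose_list (map H w)) z))
      = log_plus (sup_norm (compose_list (map ?H' (rev w)) (prod.swap z)))" if "w \<in> words n k" for w
  proof -
    have "swap_inverse (compose_list (map H w)) = compose_list (rev (map swap_inverse (map H w)))"
      by (rule swap_inverse_compose_list) (use that H henon_map_swap_inverse(1) in \<open>auto simp: words_def\<close>)
    then have "compose_list (map ?H' (rev w)) = swap_inverse (compose_list (map H w))"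
      by (simp add: rev_map comp_def)
    then show ?thesis by (simp add: swap_inverse_def sup_norm_def max.commute)
  qed
  then have "(\<Sum>w\<in>words n k. log_plus (sup_norm (inv (compose_list (map H w)) z)))
      = (\<Sum>w\<in>words n k. log_plus (sup_norm (compose_list (map ?H' (rev w)) (prod.swap z))))"
    by (intro sum.cong) auto
  also have "\<dots> = (\<Sum>w\<in>words n k. log_plus (sup_norm (compose_list (map ?H' w) (prod.swap z))))"
    by (rule sum_words_rev)
  finally show ?thesis by (simp add: green_minus_def green_plus_def deg)
qed

theorem theorem1p3:
  fixes n\<^sub>0 :: nat and H :: "nat \<Rightarrow> complex \<times> complex \<Rightarrow> complex \<times> complex"
  assumes "n\<^sub>0 \<ge> 1"
    and "\<And>i. i \<in> {1..n\<^sub>0} \<Longrightarrow> henon_map (H i)"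
  shows "(\<exists>G\<^sub>p :: complex \<times> complex \<Rightarrow> real.
            (\<forall>z. (\<lambda>k. green_plus n\<^sub>0 H k z) \<longlonglongrightarrow> G\<^sub>p z) \<and>
            plurisubharmonic_on UNIV G\<^sub>p \<and> continuous_on UNIV G\<^sub>p) \<and>
         (\<exists>G\<^sub>m :: complex \<times> complex \<Rightarrow> real.
            (\<forall>z. (\<lambda>k. green_minus n\<^sub>0 H k z) \<longlonglongrightarrow> G\<^sub>m z) \<and>
            plurisubharmonic_on UNIV G\<^sub>m \<and> continuous_on UNIV G\<^sub>m)"
proof
  obtain G where "\<And>z. (\<lambda>k. green_plus n\<^sub>0 H k z) \<longlonglongrightarrow> G z" "continuous_on UNIV G"
      "\<And>a b. circle_submean (\<lambda>s. G (complex_line a b s))"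
    using green_plus_limit[of n\<^sub>0 H] assms by blast
  then show "\<exists>G\<^sub>p :: complex \<times> complex \<Rightarrow> real.
      (\<forall>z. (\<lambda>k. green_plus n\<^sub>0 H k z) \<longlonglongrightarrow> G\<^sub>p z) \<and>
      plurisubharmonic_on UNIV G\<^sub>p \<and> continuous_on UNIV G\<^sub>p"
    using continuous_circle_submean_imp_plurisubharmonic by blast
next
  have "henon_map (swap_inverse (H i))" if "i \<in> {1..n\<^sub>0}" for i
    using henon_map_swap_inverse(2) assms(2) that by blast
  then obtain G where G: "\<And>z. (\<lambda>k. green_plus n\<^sub>0 (\<lambda>i. swap_inverse (H i)) k z) \<longlonglongrightarrow> G z"
      "continuous_on UNIV G" "\<And>a b. circle_submean (\<lambda>s. G (complex_line a b s))"
    using green_plus_limit[OF assms(1), of "\<lambda>i. swap_inverse (H i)"] by blast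
  let ?G = "\<lambda>z. G (prod.swap z)"
  have "(\<lambda>k. green_minus n\<^sub>0 H k z) \<longlonglongrightarrow> ?G z" for z
  proof -
    have "green_minus n\<^sub>0 H k z = green_plus n\<^sub>0 (\<lambda>i. swap_inverse (H i)) k (prod.swap z)" for k
      by (rule green_minus_eq_green_plus) (rule assms(2))
    then show ?thesis using G(1) by simp
  qed
  moreover have cont: "continuous_on UNIV ?G"
    unfolding prod.swap_def by (intro continuous_on_compose2[OF G(2)] continuous_intros) auto
  moreover have "plurisubharmonic_on UNIV ?G"
  proof (rule continuous_circle_submean_imp_plurisubharmonic[OF cont])
    fix a b
    \<comment> \<open>The swap is linear, so it carries complex lines to complex lines and the
      sub-mean property of \<open>G\<close> transfers.\<close>
    have "prod.swap (complex_line a b s) = complex_line (prod.swap a) (prod.swap b) s" for s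
      by (simp add: complex_line_def)
    then show "circle_submean (\<lambda>s. ?G (complex_line a b s))" using G(3) by simp
  qed
  ultimately show "\<exists>G\<^sub>m :: complex \<times> complex \<Rightarrow> real.
      (\<forall>z. (\<lambda>k. green_minus n\<^sub>0 H k z) \<longlonglongrightarrow> G\<^sub>m z) \<and>
      plurisubharmonic_on UNIV G\<^sub>m \<and> continuous_on UNIV G\<^sub>m"
    by (intro exI[of _ ?G]) auto
qed

end
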